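(* Fix an integer $N\geqslant 2$. For $\theta\in(0,1]$, let $(a_n)_{n=1}^\infty=\mathcal{G}(\theta)$, $e_m=\theta-\sum_{n=1}^m 1/a_n$ for $m\geqslant 0$, and for each $m\geqslant 1$ let $N/b_m$ (with $b_m\in\mathbb{N}$) be the largest fraction with numerator $N$ and positive integer denominator that is strictly smaller than $e_{m-1}$. The set of all $\theta\in(0,1]$ such that $1/a_m=N/b_m$ for all $m\geqslant 1$ is precisely $$\Gamma=\left\{\sum_{n=1}^\infty\frac{1}{c_n}\,:\, (c_n)_{n=1}^\infty\subset\mathbb{N},\ c_1\geqslant 2\text{ and } c_{n+1}\geqslant N c_n^2-c_n+1\text{ for all } n\geqslant 1\right\}.$$ Furthermore, $\Gamma$ contains only irrational numbers.
   Context: $\mathbb{N}$ is the set of positive integers. For $\theta\in(0,1]$ let $G(\theta)=\lfloor 1/\theta\rfloor+1$. The greedy algorithm $\mathcal{G}$ produces the sequence $\mathcal{G}(\theta)=(a_n)_{n=1}^\infty$ of positive integers defined by $a_1=G(\theta)$ and $a_m=G\left(\theta-\sum_{n=1}^{m-1}1/a_n\right)$ for $m\geqslant 2$. *)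

theory Defs
  imports Complex_Main
begin

definition greedy_G :: "real \<Rightarrow> nat" where
  "greedy_G \<theta> = nat (\<lfloor>1 / \<theta>\<rfloor> + 1)"

text \<open>Sequences are indexed from 1; the value \<open>greedy \<theta> 0\<close> carries no meaning and is never used.\<close>

function greedy :: "real \<Rightarrow> nat \<Rightarrow> nat" where
  "greedy \<theta> m = greedy_G (\<theta> - (\<Sum>n\<in>{1..<m}. 1 / real (greedy \<theta> n)))"
  by auto
termination
  by (relation "measure snd") auto

declare greedy.simps [simp del]

definition greedy_error :: "real \<Rightarrow> nat \<Rightarrow> real" where
  "greedy_error \<theta> m = \<theta> - (\<Sum>n\<in>{1..m}. 1 / real (greedy \<theta> n))"

definition largest_fraction_below :: "nat \<Rightarrow> real \<Rightarrow> nat \<Rightarrow> bool" where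
  "largest_fraction_below N x b \<longleftrightarrow>
     b \<ge> 1 \<and> real N / real b < x \<and>
     (\<forall>d\<ge>1. real N / real d < x \<longrightarrow> real N / real d \<le> real N / real b)"

lemma largest_fraction_below_ex1:
  assumes "N \<ge> 1" "x > 0"
  shows "\<exists>!b. largest_fraction_below N x b"
proof -
  let ?P = "\<lambda>b::nat. b \<ge> 1 \<and> real N / real b < x"
  obtain k :: nat where k: "real N / x < real k"
    using reals_Archimedean2 by blast
  have "real k > 0"
    using k assms by (smt (verit) divide_nonneg_pos of_nat_0_le_iff)
  hence Pk: "?P k"
    using k assms by (auto simp: field_simps)
  define b where "b = (LEAST b. ?P b)"
  have Pb: "?P b"
    unfolding b_def by (rule LeastI[of ?P, OF Pk])
  have min: "b \<le> d" if "?P d" for d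
    unfolding b_def by (rule Least_le[of ?P, OF that])
  have "largest_fraction_below N x b"
    unfolding largest_fraction_below_def
    using Pb min by (auto intro!: divide_left_mono)
  moreover have "c = b" if "largest_fraction_below N x c" for c
  proof -
    from that have c: "?P c" "real N / real b \<le> real N / real c"
      using Pb unfolding largest_fraction_below_def by auto
    hence "c \<le> b"
      using assms Pb by (auto simp: field_simps)
    with min[OF c(1)] show ?thesis by simp
  qed
  ultimately show ?thesis by blast
qed

text \<open>The recurrence is stated over the integers, so that the subtraction is not truncated.\<close>

definition Gamma_set :: "nat \<Rightarrow> real set" where
  "Gamma_set N = {s. \<exists>c :: nat \<Rightarrow> nat.
     (\<forall>n\<ge>1. c n \<ge> 1) \<and> c 1 \<ge> 2 \<and>
     (\<forall>n\<ge>1. int (c (n + 1)) \<ge> int N * (int (c n))\<^sup>2 - int (c n) + 1) \<and>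
     (\<lambda>n. 1 / real (c (n + 1))) sums s}"

end

theory Submission
  imports Defs
begin

text \<open>
  If \<open>a\<close> is the greedy denominator of a remainder \<open>x\<close>, then \<open>1 / a = N / (N a)\<close> is the largest
  fraction with numerator \<open>N\<close> below \<open>x\<close> iff \<open>x \<le> N / (N a - 1)\<close>, i.e. iff
  the next remainder \<open>x - 1 / a\<close> is at most \<open>1 / (N a\<^sup>2 - a)\<close>. This forces the next greedy
  denominator to be at least \<open>N a\<^sup>2 - a + 1\<close>. Conversely, the recurrence for \<open>c\<close> gives
  \<open>1 / c\<^sub>n \<le> N / (N c\<^sub>n - 1) - N / (N c\<^sub>n\<^sub>+\<^sub>1 - 1)\<close>, and telescoping bounds
  every tail of \<open>\<Sum> 1 / c\<^sub>n\<close> by \<open>N / (N c\<^sub>n - 1) < 1 / (c\<^sub>n - 1)\<close>. Strictness of the last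
  inequality makes the numerators of the remainders of a rational sum strictly decreasing, so the
  sum is irrational.
\<close>

section \<open>Greedy denominators and remainders\<close>

lemma greedy_G_bounds:
  assumes "0 < x" "x \<le> 1"
  shows "2 \<le> greedy_G x" "1 / real (greedy_G x) < x"
proof -
  have f: "1 \<le> \<lfloor>1 / x\<rfloor>"
    using assms by (simp add: le_floor_iff)
  have "int (greedy_G x) = \<lfloor>1 / x\<rfloor> + 1"
    using f unfolding greedy_G_def by linarith
  then have eq: "real (greedy_G x) = of_int \<lfloor>1 / x\<rfloor> + 1"
    by (metis of_int_1 of_int_add of_int_of_nat_eq)
  show "2 \<le> greedy_G x"
    using f unfolding greedy_G_def by linarith
  have "1 / x < real (greedy_G x)"
    unfolding eq by linarith
  moreover have "0 < real (greedy_G x)"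
    using \<open>2 \<le> greedy_G x\<close> by simp
  ultimately show "1 / real (greedy_G x) < x"
    using assms by (simp add: field_simps)
qed

text \<open>The interval \<open>(1 / a, 1 / (a - 1)]\<close> is exactly where the floor of
  \<open>1 / x\<close> equals \<open>a - 1\<close>. Placing a remainder in it is how a given
  sequence is later recognised as greedy.\<close>

lemma greedy_G_eqI:
  assumes "a \<ge> 2" "1 / real a < x" "x \<le> 1 / (real a - 1)"
  shows "greedy_G x = a"
proof -
  have "0 < x"
    using assms(2) by (rule le_less_trans[rotated]) simp
  then have "real a - 1 \<le> 1 / x" "1 / x < real a"
    using assms by (simp_all add: field_simps)
  then have "\<lfloor>1 / x\<rfloor> = int a - 1"
    by (intro floor_unique) simp_all
  then show ?thesis
    by (simp add: greedy_G_def)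
qed

lemma greedy_Suc: "greedy \<theta> (Suc m) = greedy_G (greedy_error \<theta> m)"
  by (subst greedy.simps) (simp add: greedy_error_def atLeastLessThanSuc_atLeastAtMost)

lemma greedy_error_0 [simp]: "greedy_error \<theta> 0 = \<theta>"
  by (simp add: greedy_error_def)

lemma greedy_error_Suc:
  "greedy_error \<theta> (Suc m) = greedy_error \<theta> m - 1 / real (greedy \<theta> (Suc m))"
  by (simp add: greedy_error_def)

lemma greedy_error_bounds:
  assumes "0 < \<theta>" "\<theta> \<le> 1"
  shows "0 < greedy_error \<theta> m \<and> greedy_error \<theta> m \<le> 1"
proof (induction m)
  case (Suc m)
  then have "1 / real (greedy \<theta> (Suc m)) < greedy_error \<theta> m"
    unfolding greedy_Suc by (intro greedy_G_bounds) auto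
  moreover have "0 \<le> 1 / real (greedy \<theta> (Suc m))"
    by simp
  ultimately show ?case
    using Suc unfolding greedy_error_Suc by linarith
qed (use assms in simp)

section \<open>Largest fractions with numerator \<open>N\<close>\<close>

text \<open>Since \<open>N / d\<close> decreases in \<open>d\<close>, only the neighbouring
  denominator \<open>b - 1\<close> has to be ruled out; \<open>b \<ge> 2\<close> makes it an
  admissible competitor.\<close>

lemma largest_fraction_below_iff:
  assumes "N \<ge> 1" "b \<ge> 2"
  shows "largest_fraction_below N x b \<longleftrightarrow> real N / real b < x \<and> x \<le> real N / (real b - 1)"
proof
  assume *: "largest_fraction_below N x b"
  have "\<not> real N / real (b - 1) < x"
  proof
    assume "real N / real (b - 1) < x"
    moreover have "b - 1 \<ge> 1"
      using assms by simp
    ultimately have "real N / real (b - 1) \<le> real N / real b"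
      using * unfolding largest_fraction_below_def by blast
    then show False
      using assms by (simp add: field_simps of_nat_diff)
  qed
  then show "real N / real b < x \<and> x \<le> real N / (real b - 1)"
    using * assms unfolding largest_fraction_below_def by (simp add: of_nat_diff)
next
  assume *: "real N / real b < x \<and> x \<le> real N / (real b - 1)"
  have "real N / real d \<le> real N / real b" if "d \<ge> 1" "real N / real d < x" for d
  proof -
    have "\<not> real d \<le> real b - 1"
    proof
      assume "real d \<le> real b - 1"
      then have "real N / (real b - 1) \<le> real N / real d"
        using that(1) by (intro divide_left_mono) auto
      then show False
        using that(2) * by linarith
    qed
    then have "b \<le> d"
      by linarith
    then show ?thesis
      using assms by (intro divide_left_mono) auto
  qed
  then show "largest_fraction_below N x b"
    using * assms unfolding largest_fraction_below_def by auto
qed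

section \<open>Growth and tails under the recurrence\<close>

text \<open>With \<open>t = N c - 1\<close> one has
  \<open>N / t - 1 / c = 1 / (c t) = N / (N c t)\<close>, while the recurrence reads
  \<open>c' \<ge> c t + 1\<close> and hence gives \<open>N c' - 1 \<ge> N c t\<close>.\<close>

lemma recurrence_telescope:
  fixes c c' N :: nat
  assumes "N \<ge> 2" "c \<ge> 2" and rec: "int c' \<ge> int N * (int c)\<^sup>2 - int c + 1"
  shows "1 / real c \<le> real N / (real N * real c - 1) - real N / (real N * real c' - 1)"
proof -
  define t where "t = real N * real c - 1"
  have "2 * 2 \<le> real N * real c"
    using assms by (intro mult_mono) auto
  then have t: "t > 0"
    by (simp add: t_def)
  have "real_of_int (int c') \<ge> real_of_int (int N * (int c)\<^sup>2 - int c + 1)"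
    using rec by (rule of_int_le_iff[THEN iffD2])
  then have c': "real c' \<ge> real c * t + 1"
    by (simp add: t_def power2_eq_square algebra_simps)
  have "real N * (real c * t + 1) \<le> real N * real c'"
    using c' by (intro mult_left_mono) auto
  then have "real N * (real c * t) \<le> real N * real c' - 1"
    using assms by (simp add: algebra_simps)
  moreover have "0 < real N * (real c * t)"
    using assms t by simp
  ultimately have "real N / (real N * real c' - 1) \<le> real N / (real N * (real c * t))"
    by (intro divide_left_mono) auto
  also have "\<dots> = real N / t - 1 / real c"
    using assms t by (simp add: t_def field_simps)
  finally show ?thesis
    by (simp add: t_def)
qed

lemma recurrence_strict_increasing:
  fixes c c' N :: nat
  assumes "N \<ge> 2" "c \<ge> 2" and rec: "int c' \<ge> int N * (int c)\<^sup>2 - int c + 1"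
  shows "c < c'"
proof -
  have "2 * 2 \<le> int N * int c"
    using assms by (intro mult_mono) auto
  then have "int c * 2 \<le> int c * (int N * int c)"
    by (intro mult_left_mono) auto
  then show ?thesis
    using rec by (simp add: power2_eq_square algebra_simps)
qed

text \<open>A crude linear bound obtained from strict monotonicity. It keeps every denominator at
  least 2 and, for the greedy sequence, forces the remainders to vanish.\<close>

lemma recurrence_ge:
  fixes c :: "nat \<Rightarrow> nat"
  assumes "N \<ge> 2" "c 1 \<ge> 2"
    and "\<forall>n\<ge>1. int (c (n + 1)) \<ge> int N * (int (c n))\<^sup>2 - int (c n) + 1"
  shows "c (Suc n) \<ge> n + 2"
proof (induction n)
  case (Suc n)
  have "c (Suc n) < c (Suc (Suc n))"
    using Suc assms by (intro recurrence_strict_increasing[of N]) auto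
  with Suc show ?case
    by simp
qed (use assms in simp)

lemma recurrence_tail_bounds:
  fixes c :: "nat \<Rightarrow> nat"
  assumes "N \<ge> 2" "c 1 \<ge> 2"
    and rec: "\<forall>n\<ge>1. int (c (n + 1)) \<ge> int N * (int (c n))\<^sup>2 - int (c n) + 1"
    and sums: "(\<lambda>n. 1 / real (c (n + 1))) sums s"
  defines "r \<equiv> \<lambda>m. s - (\<Sum>n<m. 1 / real (c (n + 1)))"
  shows "1 / real (c (m + 1)) < r m"
    and "r m \<le> real N / (real N * real (c (m + 1)) - 1)"
proof -
  have c_ge: "c (Suc n) \<ge> 2" for n
    using recurrence_ge[OF assms(1-3), of n] by simp
  have tail: "(\<lambda>n. 1 / real (c (n + m + 1))) sums r m"
    using sums_split_initial_segment[OF sums, of m] by (simp add: r_def)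
  have pos: "0 < 1 / real (c (Suc n))" for n
    using c_ge[of n] by simp
  \<comment> \<open>Two terms of the tail are kept, not one, so that the positive second term makes
    the lower bound strict.\<close>
  have "(\<Sum>n<2. 1 / real (c (n + m + 1))) \<le> (\<Sum>n. 1 / real (c (n + m + 1)))"
    using tail by (intro sum_le_suminf) (auto simp: sums_iff)
  then have "1 / real (c (m + 1)) + 1 / real (c (Suc (Suc m))) \<le> r m"
    using tail by (simp add: sums_iff numeral_2_eq_2)
  then show "1 / real (c (m + 1)) < r m"
    using pos[of "Suc m"] by linarith
  define f where "f n = real N / (real N * real (c (n + m + 1)) - 1)" for n
  have f_nonneg: "0 \<le> f n" for n
  proof -
    have "1 * 1 \<le> real N * real (c (n + m + 1))"
      using c_ge[of "n + m"] assms(1) by (intro mult_mono) auto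
    then show ?thesis
      by (simp add: f_def)
  qed
  have "(\<Sum>n<k. 1 / real (c (n + m + 1))) \<le> f 0" for k
  proof -
    have "(\<Sum>n<k. 1 / real (c (n + m + 1))) \<le> (\<Sum>n<k. f n - f (Suc n))"
    proof (rule sum_mono)
      fix n
      show "1 / real (c (n + m + 1)) \<le> f n - f (Suc n)"
        using recurrence_telescope[of N "c (n + m + 1)" "c (n + m + 1 + 1)"] rec assms(1)
          c_ge[of "n + m"] by (simp add: f_def)
    qed
    also have "\<dots> = f 0 - f k"
      by (rule sum_lessThan_telescope')
    finally show ?thesis
      using f_nonneg[of k] by linarith
  qed
  then have "r m \<le> f 0"
    using tail unfolding sums_def by (intro LIMSEQ_le_const2) auto
  then show "r m \<le> real N / (real N * real (c (m + 1)) - 1)"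
    by (simp add: f_def)
qed

text \<open>Cross-multiplication reduces this to \<open>N > 1\<close>; for \<open>N = 1\<close> both
  sides coincide. The strictness gained here is what drives the descent in the irrationality
  proof.\<close>

lemma fraction_below_greedy_bound:
  fixes N a :: nat
  assumes "N \<ge> 2" "a \<ge> 2"
  shows "real N / (real N * real a - 1) < 1 / (real a - 1)"
proof -
  have "2 * 2 \<le> real N * real a"
    using assms by (intro mult_mono) auto
  then show ?thesis
    using assms by (simp add: field_simps)
qed

section \<open>Greedy expansion of a sum obeying the recurrence\<close>

text \<open>The tail bounds put the remainder after \<open>m\<close> terms in the interval where the
  greedy choice is \<open>c (Suc m)\<close>, so by induction the greedy remainders are the tails of
  the series.\<close>

lemma greedy_eq_recurrence:
  fixes c :: "nat \<Rightarrow> nat"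
  assumes "N \<ge> 2" "c 1 \<ge> 2"
    and "\<forall>n\<ge>1. int (c (n + 1)) \<ge> int N * (int (c n))\<^sup>2 - int (c n) + 1"
    and "(\<lambda>n. 1 / real (c (n + 1))) sums s"
  shows "greedy s (Suc m) = c (Suc m)"
    and "greedy_error s m = s - (\<Sum>n<m. 1 / real (c (n + 1)))"
proof -
  have step: "greedy_G (s - (\<Sum>n<m. 1 / real (c (n + 1)))) = c (Suc m)" for m
  proof (rule greedy_G_eqI)
    show c: "c (Suc m) \<ge> 2"
      using recurrence_ge[OF assms(1-3), of m] by simp
    show "1 / real (c (Suc m)) < s - (\<Sum>n<m. 1 / real (c (n + 1)))"
      using recurrence_tail_bounds(1)[OF assms, of m] by simp
    show "s - (\<Sum>n<m. 1 / real (c (n + 1))) \<le> 1 / (real (c (Suc m)) - 1)"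
      using recurrence_tail_bounds(2)[OF assms, of m]
        fraction_below_greedy_bound[OF assms(1) c] by simp
  qed
  have err: "greedy_error s m = s - (\<Sum>n<m. 1 / real (c (n + 1)))" for m
  proof (induction m)
    case (Suc m)
    then have "greedy s (Suc m) = c (Suc m)"
      using step[of m] by (simp add: greedy_Suc)
    with Suc show ?case
      by (simp add: greedy_error_Suc)
  qed simp
  show "greedy s (Suc m) = c (Suc m)"
    using step[of m] by (simp add: greedy_Suc err)
  show "greedy_error s m = s - (\<Sum>n<m. 1 / real (c (n + 1)))"
    by (rule err)
qed

section \<open>Irrationality by descent\<close>

lemma strict_greedy_remainders_irrational:
  fixes a :: "nat \<Rightarrow> nat" and r :: "nat \<Rightarrow> real"
  assumes a: "\<And>m. a m \<ge> 2"
    and rec: "\<And>m. r (Suc m) = r m - 1 / real (a m)"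
    and pos: "\<And>m. 0 < r m"
    and less: "\<And>m. r m < 1 / (real (a m) - 1)"
  shows "r 0 \<notin> \<rat>"
proof
  have no_fraction: "r m \<noteq> real p / real q" if "q > 0" for m p q
    using that
  \<comment> \<open>The descent is on the numerator alone: \<open>m\<close> and \<open>q\<close>
    change at each step, and the fractions need not be in lowest terms.\<close>
  proof (induction p arbitrary: m q rule: less_induct)
    case (less p)
    show ?case
    proof
      assume eq: "r m = real p / real q"
      \<comment> \<open>The numerator of \<open>r (Suc m)\<close> over \<open>q * a m\<close>,
        formed over the integers to avoid truncation. Positivity of \<open>r (Suc m)\<close> makes
        it positive, and \<open>r m < 1 / (a m - 1)\<close> makes it smaller than
        \<open>p\<close>.\<close>
      define p' where "p' = int p * int (a m) - int q"
      have r': "r (Suc m) = real_of_int p' / real (q * a m)"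
        using a[of m] less.prems by (simp add: rec eq p'_def field_simps)
      have "0 < real_of_int p' / real (q * a m)"
        using pos[of "Suc m"] r' by simp
      moreover have "0 < real (q * a m)"
        using a[of m] less.prems by simp
      ultimately have p'_pos: "p' > 0"
        by (simp only: zero_less_divide_iff) simp
      have "real p * (real (a m) - 1) < real q"
        using assms(4)[of m] a[of m] less.prems by (simp add: eq field_simps)
      then have "real_of_int p' < real_of_int (int p)"
        by (simp add: p'_def algebra_simps)
      then have "p' < int p"
        by (simp only: of_int_less_iff)
      then have "nat p' < p"
        using p'_pos by simp
      then have "r (Suc m) \<noteq> real (nat p') / real (q * a m)"
        using less.prems a[of m] by (intro less.IH) auto
      then show False
        using r' p'_pos by simp
    qed
  qed
  assume "r 0 \<in> \<rat>"
  then obtain p q :: nat where "q \<noteq> 0" "\<bar>r 0\<bar> = real p / real q"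
    using Rats_abs_nat_div_natE by metis
  then show False
    using no_fraction[of q 0 p] pos[of 0] by simp
qed

lemma Gamma_set_irrational:
  assumes "N \<ge> 2" "s \<in> Gamma_set N"
  shows "s \<notin> \<rat>"
proof -
  obtain c :: "nat \<Rightarrow> nat" where c: "c 1 \<ge> 2"
      "\<forall>n\<ge>1. int (c (n + 1)) \<ge> int N * (int (c n))\<^sup>2 - int (c n) + 1"
      "(\<lambda>n. 1 / real (c (n + 1))) sums s"
    using assms(2) unfolding Gamma_set_def by blast
  define r where "r m = s - (\<Sum>n<m. 1 / real (c (n + 1)))" for m
  have c_ge: "c (Suc m) \<ge> 2" for m
    using recurrence_ge[OF assms(1) c(1,2), of m] by simp
  have "r 0 \<notin> \<rat>"
  proof (rule strict_greedy_remainders_irrational)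
    fix m
    show "c (Suc m) \<ge> 2"
      by (rule c_ge)
    show "r (Suc m) = r m - 1 / real (c (Suc m))"
      by (simp add: r_def)
    have "0 \<le> 1 / real (c (Suc m))"
      by simp
    then show "0 < r m"
      using recurrence_tail_bounds(1)[OF assms(1) c, of m] unfolding r_def Suc_eq_plus1 by linarith
    show "r m < 1 / (real (c (Suc m)) - 1)"
      using recurrence_tail_bounds(2)[OF assms(1) c, of m]
        fraction_below_greedy_bound[OF assms(1) c_ge, of m] by (simp add: r_def)
  qed
  then show ?thesis
    by (simp add: r_def)
qed

section \<open>The two inclusions\<close>

text \<open>As \<open>c\<close> is the greedy sequence of \<open>s\<close>, its tail bounds are
  precisely the two inequalities of \<open>largest_fraction_below_iff\<close> for the denominator
  \<open>N * c (Suc m)\<close>.\<close>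

lemma Gamma_set_imp_largest_fractions:
  assumes "N \<ge> 2" "s \<in> Gamma_set N"
  shows "0 < s" "s \<le> 1"
    and "largest_fraction_below N (greedy_error s m) (N * greedy s (Suc m))"
    and "greedy s (Suc m) > 0"
proof -
  obtain c :: "nat \<Rightarrow> nat" where c: "c 1 \<ge> 2"
      "\<forall>n\<ge>1. int (c (n + 1)) \<ge> int N * (int (c n))\<^sup>2 - int (c n) + 1"
      "(\<lambda>n. 1 / real (c (n + 1))) sums s"
    using assms(2) unfolding Gamma_set_def by blast
  have c_ge: "c (Suc m) \<ge> 2" for m
    using recurrence_ge[OF assms(1) c(1,2), of m] by simp
  note bounds = recurrence_tail_bounds[OF assms(1) c]
  have "1 / real (c 1) < s"
    using bounds(1)[of 0] by simp
  then show "0 < s"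
    by (rule le_less_trans[rotated]) simp
  have "s < 1 / (real (c 1) - 1)"
    using bounds(2)[of 0] fraction_below_greedy_bound[OF assms(1) c(1)] by simp
  also have "\<dots> \<le> 1"
    using c(1) by simp
  finally show "s \<le> 1"
    by simp
  have "2 * 1 \<le> N * c (Suc m)"
    using assms(1) c_ge[of m] by (intro mult_le_mono) auto
  then show "largest_fraction_below N (greedy_error s m) (N * greedy s (Suc m))"
    using bounds[of m] assms(1)
    by (subst largest_fraction_below_iff) (auto simp: greedy_eq_recurrence[OF assms(1) c])
  show "greedy s (Suc m) > 0"
    using c_ge[of m] by (simp add: greedy_eq_recurrence[OF assms(1) c])
qed

text \<open>The witness is the greedy sequence itself. Besides the recurrence, its series must be
  shown to add up to \<open>\<theta>\<close>; this follows from the growth that the recurrence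
  imposes.\<close>

lemma largest_fractions_imp_Gamma_set:
  assumes N: "N \<ge> 2" and \<theta>: "0 < \<theta>" "\<theta> \<le> 1"
    and largest: "\<And>m. largest_fraction_below N (greedy_error \<theta> m) (N * greedy \<theta> (Suc m))"
  shows "\<theta> \<in> Gamma_set N"
proof -
  define a where "a m = greedy \<theta> m" for m
  have err: "0 < greedy_error \<theta> m" "greedy_error \<theta> m \<le> 1" for m
    using greedy_error_bounds[OF \<theta>, of m] by auto
  have a_ge: "a (Suc m) \<ge> 2" for m
    unfolding a_def greedy_Suc using err by (rule greedy_G_bounds)
  have err_le: "greedy_error \<theta> (Suc m) \<le> 1 / (real N * (real (a (Suc m)))\<^sup>2 - real (a (Suc m)))"
    and den_pos: "0 < real N * (real (a (Suc m)))\<^sup>2 - real (a (Suc m))" for m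
  proof -
    have prod: "2 * 2 \<le> N * a (Suc m)"
      using N a_ge[of m] by (intro mult_le_mono) auto
    then have prod': "4 \<le> real N * real (a (Suc m))"
      by (metis mult_2_right numeral_Bit0 of_nat_le_iff of_nat_mult of_nat_numeral)
    have "greedy_error \<theta> m \<le> real N / (real (N * a (Suc m)) - 1)"
      using largest[of m] prod N by (subst (asm) largest_fraction_below_iff) (auto simp: a_def)
    then have "greedy_error \<theta> (Suc m)
        \<le> real N / (real N * real (a (Suc m)) - 1) - 1 / real (a (Suc m))"
      by (simp add: greedy_error_Suc a_def)
    also have "\<dots> = 1 / (real (a (Suc m)) * (real N * real (a (Suc m)) - 1))"
      using prod' a_ge[of m] by (simp add: field_simps)
    finally show "greedy_error \<theta> (Suc m)
        \<le> 1 / (real N * (real (a (Suc m)))\<^sup>2 - real (a (Suc m)))"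
      by (simp add: power2_eq_square algebra_simps)
    have "0 < real (a (Suc m)) * (real N * real (a (Suc m)) - 1)"
      using prod' a_ge[of m] by simp
    then show "0 < real N * (real (a (Suc m)))\<^sup>2 - real (a (Suc m))"
      by (simp add: power2_eq_square algebra_simps)
  qed
  have rec: "\<forall>n\<ge>1. int (a (n + 1)) \<ge> int N * (int (a n))\<^sup>2 - int (a n) + 1"
  proof (intro allI impI)
    fix n :: nat
    assume "n \<ge> 1"
    then obtain m where n: "n = Suc m"
      by (cases n) auto
    \<comment> \<open>Taking \<open>D\<close> as an integer lets the strict bound
      \<open>D < a (Suc n)\<close> improve to a gap of one, which is the \<open>+ 1\<close> of the
      recurrence.\<close>
    define D where "D = int N * (int (a n))\<^sup>2 - int (a n)"
    have D: "real_of_int D = real N * (real (a n))\<^sup>2 - real (a n)"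
      by (simp add: D_def)
    have "1 / real (a (Suc n)) < greedy_error \<theta> n"
      unfolding a_def greedy_Suc using err by (rule greedy_G_bounds)
    also have "\<dots> \<le> 1 / real_of_int D"
      using err_le[of m] by (simp add: D n)
    finally have "real_of_int D < real (a (Suc n))"
      using den_pos[of m] a_ge[of n] by (simp add: D n field_simps)
    then have "D < int (a (Suc n))"
      by linarith
    then show "int (a (n + 1)) \<ge> int N * (int (a n))\<^sup>2 - int (a n) + 1"
      by (simp add: D_def)
  qed
  have "greedy_error \<theta> \<longlonglongrightarrow> 0"
  proof (rule LIMSEQ_imp_Suc, rule LIMSEQ_imp_Suc, rule tendsto_sandwich)
    have "greedy_error \<theta> (Suc (Suc m)) \<le> inverse (real (Suc m))" for m
    proof -
      \<comment> \<open>\<open>recurrence_ge\<close> makes this denominator at least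
        \<open>m + 4\<close>. A greedy denominator minus one is the floor of the reciprocal of the
        remainder, so large denominators mean small remainders.\<close>
      have "real (Suc m) \<le> real (a (Suc (Suc (Suc m)))) - 1"
        using recurrence_ge[OF N _ rec, of "Suc (Suc m)"] a_ge[of 0] by simp
      also have "\<dots> \<le> 1 / greedy_error \<theta> (Suc (Suc m))"
        using err[of "Suc (Suc m)"] unfolding a_def greedy_Suc greedy_G_def by simp
      finally show ?thesis
        using err[of "Suc (Suc m)"] by (simp add: field_simps)
    qed
    then show "\<forall>\<^sub>F m in sequentially. greedy_error \<theta> (Suc (Suc m)) \<le> inverse (real (Suc m))"
      by simp
    show "\<forall>\<^sub>F m in sequentially. 0 \<le> greedy_error \<theta> (Suc (Suc m))"
      using err(1) by (simp add: less_imp_le)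
    show "(\<lambda>_::nat. 0::real) \<longlonglongrightarrow> 0"
      by simp
    show "(\<lambda>m. inverse (real (Suc m))) \<longlonglongrightarrow> 0"
      by (rule LIMSEQ_inverse_real_of_nat)
  qed
  then have "(\<lambda>m. \<theta> - greedy_error \<theta> m) \<longlonglongrightarrow> \<theta> - 0"
    by (intro tendsto_intros)
  moreover have "\<theta> - greedy_error \<theta> m = (\<Sum>n<m. 1 / real (a (n + 1)))" for m
    by (induction m) (simp_all add: greedy_error_Suc a_def)
  ultimately have "(\<lambda>n. 1 / real (a (n + 1))) sums \<theta>"
    by (simp add: sums_def)
  moreover have "\<forall>n\<ge>1. a n \<ge> 1"
    using a_ge by (metis One_nat_def Suc_le_D le_trans one_le_numeral)
  ultimately show ?thesis
    unfolding Gamma_set_def using rec a_ge[of 0] by (auto intro!: exI[of _ a])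
qed

theorem corollary1p8:
  fixes N :: nat
  assumes "N \<ge> 2"
  shows "{\<theta> \<in> {0<..1}. \<exists>b :: nat \<Rightarrow> nat.
            (\<forall>m\<ge>1. largest_fraction_below N (greedy_error \<theta> (m - 1)) (b m)) \<and>
            (\<forall>m\<ge>1. 1 / real (greedy \<theta> m) = real N / real (b m))} = Gamma_set N
         \<and> (\<forall>\<theta>\<in>Gamma_set N. \<theta> \<notin> \<rat>)"
proof (intro conjI equalityI subsetI ballI)
  fix \<theta>
  assume "\<theta> \<in> {\<theta> \<in> {0<..1}. \<exists>b :: nat \<Rightarrow> nat.
            (\<forall>m\<ge>1. largest_fraction_below N (greedy_error \<theta> (m - 1)) (b m)) \<and>
            (\<forall>m\<ge>1. 1 / real (greedy \<theta> m) = real N / real (b m))}"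
  then obtain b :: "nat \<Rightarrow> nat" where \<theta>: "0 < \<theta>" "\<theta> \<le> 1"
    and b: "\<forall>m\<ge>1. largest_fraction_below N (greedy_error \<theta> (m - 1)) (b m)"
    and eq: "\<forall>m\<ge>1. 1 / real (greedy \<theta> m) = real N / real (b m)"
    by auto
  show "\<theta> \<in> Gamma_set N"
  proof (rule largest_fractions_imp_Gamma_set[OF assms \<theta>])
    fix m
    have b_m: "largest_fraction_below N (greedy_error \<theta> m) (b (Suc m))"
      using b[rule_format, of "Suc m"] by simp
    \<comment> \<open>Division by zero yields 0, so both denominators are shown to be nonzero before
      \<open>eq\<close> is cross-multiplied.\<close>
    have "b (Suc m) \<ge> 1"
      using b_m by (simp add: largest_fraction_below_def)
    moreover have "greedy \<theta> (Suc m) \<ge> 2"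
      unfolding greedy_Suc using greedy_error_bounds[OF \<theta>] by (intro greedy_G_bounds) auto
    ultimately have "real (b (Suc m)) = real (N * greedy \<theta> (Suc m))"
      using eq[rule_format, of "Suc m"] by (simp add: field_simps)
    then have "b (Suc m) = N * greedy \<theta> (Suc m)"
      by (simp only: of_nat_eq_iff)
    with b_m show "largest_fraction_below N (greedy_error \<theta> m) (N * greedy \<theta> (Suc m))"
      by simp
  qed
next
  fix \<theta>
  assume \<theta>: "\<theta> \<in> Gamma_set N"
  note G = Gamma_set_imp_largest_fractions[OF assms \<theta>]
  have "\<forall>m\<ge>1. largest_fraction_below N (greedy_error \<theta> (m - 1)) (N * greedy \<theta> m)"
    using G(3) by (metis One_nat_def Suc_le_D diff_Suc_1)
  moreover have "\<forall>m\<ge>1. 1 / real (greedy \<theta> m) = real N / real (N * greedy \<theta> m)"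
    using assms by simp
  ultimately show "\<theta> \<in> {\<theta> \<in> {0<..1}. \<exists>b :: nat \<Rightarrow> nat.
            (\<forall>m\<ge>1. largest_fraction_below N (greedy_error \<theta> (m - 1)) (b m)) \<and>
            (\<forall>m\<ge>1. 1 / real (greedy \<theta> m) = real N / real (b m))}"
    using G(1,2) by (auto intro!: exI[of _ "\<lambda>m. N * greedy \<theta> m"])
next
  fix \<theta>
  assume "\<theta> \<in> Gamma_set N"
  then show "\<theta> \<notin> \<rat>"
    by (rule Gamma_set_irrational[OF assms])
qed

end
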